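(* For any $A\in SPD(n)$ there exists an orthonormal basis $\{e_k\}$ of $(T_ASPD(n),g_W|_A)$ such that for any two distinct elements $e_{k_1},e_{k_2}\in\{e_k\}$, $$0<K_A(e_{k_1},e_{k_2})<\frac{3}{\lambda_{\min}(A)},$$ where $\lambda_{\min}(A)$ is the minimal eigenvalue of $A$.
   Context: $SPD(n)$ is the set of real symmetric positive-definite $n\times n$ matrices, an open subset of the space $Sym(n)$ of real symmetric matrices, so $T_ASPD(n)\cong Sym(n)$. For $A\in SPD(n)$ and a real $n\times n$ matrix $X$, $\Gamma_A[X]$ denotes the unique real matrix satisfying $A\,\Gamma_A[X]+\Gamma_A[X]\,A=X$. The Wasserstein metric is the Riemannian metric $g_W|_A(X,Y)=\mathrm{tr}(\Gamma_A[Y]\,A\,\Gamma_A[X])=\frac12\mathrm{tr}(\Gamma_A[Y]X)$ for $X,Y\in T_ASPD(n)$. $K_A(X,Y)$ denotes the sectional curvature of $g_W$ at $A$ of the plane spanned by linearly independent $X,Y\in T_ASPD(n)$ (positive on round spheres). *)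

theory Defs
  imports "HOL-Analysis.Analysis"
begin

section \<open>Riemannian geometry on an open subset of a linear subspace\<close>

text \<open>
  Here \<open>V\<close> is a linear subspace of the ambient space and \<open>M \<subseteq> V\<close> is open in \<open>V\<close>, so that
  every tangent space of \<open>M\<close> is \<open>V\<close>.  Tensor fields and vector fields on \<open>M\<close> are functions of
  the base point, taken first; only their values at base points in \<open>M\<close> and at vectors in \<open>V\<close>
  are meaningful.
\<close>

definition dir_deriv ::
  "('a::real_normed_vector \<Rightarrow> 'b::real_normed_vector) \<Rightarrow> 'a \<Rightarrow> 'a \<Rightarrow> 'b" where
  "dir_deriv F A X = vector_derivative (\<lambda>t::real. F (A + t *\<^sub>R X)) (at 0)"

text \<open>
  In the global chart \<open>M \<subseteq> V\<close>, every affine connection has the form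
  \<open>\<nabla>\<^sub>X Y = D\<^sub>X Y + G(X, Y)\<close>, where \<open>G A\<close> is a bilinear map \<open>V \<times> V \<rightarrow> V\<close> for every \<open>A \<in> M\<close>
  (the Christoffel symbols).
\<close>

definition cov_deriv ::
  "('a::real_normed_vector \<Rightarrow> 'a \<Rightarrow> 'a \<Rightarrow> 'a) \<Rightarrow> ('a \<Rightarrow> 'a) \<Rightarrow> ('a \<Rightarrow> 'a) \<Rightarrow> ('a \<Rightarrow> 'a)" where
  "cov_deriv G X Y = (\<lambda>A. dir_deriv Y A (X A) + G A (X A) (Y A))"

definition lie_bracket ::
  "('a::real_normed_vector \<Rightarrow> 'a) \<Rightarrow> ('a \<Rightarrow> 'a) \<Rightarrow> ('a \<Rightarrow> 'a)" where
  "lie_bracket X Y = (\<lambda>A. dir_deriv Y A (X A) - dir_deriv X A (Y A))"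

text \<open>
  The Levi-Civita connection: symmetry of \<open>G A\<close> is torsion-freeness of \<open>D + G\<close>, and the last
  clause is compatibility with the metric.  Both conditions are tensorial, so it suffices to state
  them for constant vector fields.
\<close>

definition is_levi_civita ::
  "'a::real_normed_vector set \<Rightarrow> 'a set \<Rightarrow> ('a \<Rightarrow> 'a \<Rightarrow> 'a \<Rightarrow> real)
    \<Rightarrow> ('a \<Rightarrow> 'a \<Rightarrow> 'a \<Rightarrow> 'a) \<Rightarrow> bool" where
  "is_levi_civita V M g G \<longleftrightarrow>
     (\<forall>A\<in>M.
        (\<forall>X\<in>V. \<forall>Y\<in>V. G A X Y \<in> V) \<and>
        (\<forall>X\<in>V. \<forall>Y\<in>V. \<forall>Z\<in>V. G A (X + Y) Z = G A X Z + G A Y Z) \<and>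
        (\<forall>X\<in>V. \<forall>Y\<in>V. \<forall>c. G A (c *\<^sub>R X) Y = c *\<^sub>R G A X Y) \<and>
        (\<forall>X\<in>V. \<forall>Y\<in>V. G A X Y = G A Y X) \<and>
        (\<forall>X\<in>V. \<forall>Y\<in>V. \<forall>Z\<in>V.
           dir_deriv (\<lambda>B. g B Y Z) A X = g A (G A X Y) Z + g A Y (G A X Z)))"

text \<open>
  For \<open>g\<close> a Riemannian metric, the predicate above determines \<open>G A X Y\<close> for \<open>A \<in> M\<close> and \<open>X, Y \<in> V\<close>; the choice operator only
  affects the irrelevant values elsewhere.
\<close>

definition levi_civita ::
  "'a::real_normed_vector set \<Rightarrow> 'a set \<Rightarrow> ('a \<Rightarrow> 'a \<Rightarrow> 'a \<Rightarrow> real) \<Rightarrow> ('a \<Rightarrow> 'a \<Rightarrow> 'a \<Rightarrow> 'a)" where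
  "levi_civita V M g = (SOME G. is_levi_civita V M g G)"

definition riemann_curvature ::
  "('a::real_normed_vector \<Rightarrow> 'a \<Rightarrow> 'a \<Rightarrow> 'a) \<Rightarrow> ('a \<Rightarrow> 'a) \<Rightarrow> ('a \<Rightarrow> 'a) \<Rightarrow> ('a \<Rightarrow> 'a) \<Rightarrow> ('a \<Rightarrow> 'a)"
  where
  "riemann_curvature G X Y Z =
     (\<lambda>A. cov_deriv G X (cov_deriv G Y Z) A - cov_deriv G Y (cov_deriv G X Z) A
          - cov_deriv G (lie_bracket X Y) Z A)"

text \<open>
  The curvature is tensorial, so tangent vectors may be extended to any vector fields; the constant
  extensions are used.  With the sign conventions chosen, round spheres have positive sectional
  curvature.
\<close>

definition sectional_curvature ::
  "'a::real_normed_vector set \<Rightarrow> 'a set \<Rightarrow> ('a \<Rightarrow> 'a \<Rightarrow> 'a \<Rightarrow> real) \<Rightarrow> 'a \<Rightarrow> 'a \<Rightarrow> 'a \<Rightarrow> real" where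
  "sectional_curvature V M g A X Y =
     g A (riemann_curvature (levi_civita V M g) (\<lambda>_. X) (\<lambda>_. Y) (\<lambda>_. Y) A) X
       / (g A X X * g A Y Y - (g A X Y)\<^sup>2)"

definition orthonormal_basis_of ::
  "'a::real_vector set \<Rightarrow> ('a \<Rightarrow> 'a \<Rightarrow> real) \<Rightarrow> 'a set \<Rightarrow> bool" where
  "orthonormal_basis_of V h B \<longleftrightarrow>
     B \<subseteq> V \<and> independent B \<and> span B = V \<and>
     (\<forall>e\<in>B. h e e = 1) \<and> (\<forall>e\<in>B. \<forall>f\<in>B. e \<noteq> f \<longrightarrow> h e f = 0)"


section \<open>The Wasserstein metric on positive-definite matrices\<close>

definition Sym :: "(real^'n^'n) set" where
  "Sym = {X. transpose X = X}"

definition SPD :: "(real^'n^'n) set" where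
  "SPD = {A \<in> Sym. \<forall>x. x \<noteq> 0 \<longrightarrow> x \<bullet> (A *v x) > 0}"

text \<open>
  \<open>sylv A X\<close> is \<open>\<Gamma>\<^sub>A[X]\<close>; for \<open>A\<close> positive definite the Sylvester equation has exactly one solution.
\<close>

definition sylv :: "real^'n^'n \<Rightarrow> real^'n^'n \<Rightarrow> real^'n^'n" where
  "sylv A X = (THE S. A ** S + S ** A = X)"

definition gW :: "real^'n^'n \<Rightarrow> real^'n^'n \<Rightarrow> real^'n^'n \<Rightarrow> real" where
  "gW A X Y = trace (sylv A Y ** A ** sylv A X)"

definition KW :: "real^'n^'n \<Rightarrow> real^'n^'n \<Rightarrow> real^'n^'n \<Rightarrow> real" where
  "KW = sectional_curvature Sym SPD gW"

definition lambda_min :: "real^'n^'n \<Rightarrow> real" where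
  "lambda_min A = (LEAST l. \<exists>v. v \<noteq> 0 \<and> A *v v = l *\<^sub>R v)"

end

theory Submission
  imports Defs
begin

text \<open>
  Write \<open>S = \<Gamma>\<^sub>A[X]\<close> and \<open>T = \<Gamma>\<^sub>A[Y]\<close>. The Christoffel symbol of \<open>g\<^sub>W\<close> is \<open>- (S A T + T A S)\<close>, and for
  \<open>K = S T - T S\<close>, \<open>N = \<Gamma>\<^sub>A[A K - K A]\<close> and \<open>E = N + K\<close> the curvature is
  \<open>g\<^sub>W(R(X, Y)Y, X) = 3/4 (tr(K A K\<^sup>T) - tr(N A N)) = 3/4 tr(E A E\<^sup>T)\<close>. Here \<open>N\<close> is symmetric and \<open>K\<close> skew, so
  this is positive unless \<open>S\<close> and \<open>T\<close> commute. Dropping the \<open>N\<close>-term, the upper bound follows from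
  \<open>tr(K A K\<^sup>T) \<le> 2 (tr(T S A S T) + tr(S T A T S))\<close> and from the Cauchy-Schwarz estimate
  \<open>tr(T S A S T) < |T|\<^sup>2 tr(S A S)\<close>, where equality would make \<open>S\<close> and \<open>T\<close> commute. It remains to find an
  orthonormal basis without commuting pairs: an orthonormal basis with the fewest commuting pairs has
  none, since otherwise a small rotation in the plane of two basis vectors would remove one.
\<close>

section \<open>Trace forms of positive-definite matrices\<close>

interpretation mm: bounded_bilinear
  "(**) :: real^'n^'m \<Rightarrow> real^'p^'n \<Rightarrow> real^'p^'m"
  unfolding bilinear_conv_bounded_bilinear[symmetric] bilinear_def
  by (auto intro!: linearI simp: matrix_matrix_mult_def vec_eq_iff sum.distrib sum_distrib_left algebra_simps)

lemma linear_trace: "linear (trace :: real^'n^'n \<Rightarrow> real)"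
  by (auto intro!: linearI simp: trace_def sum.distrib sum_distrib_left)


lemma linear_transpose: "linear (transpose :: real^'n^'m \<Rightarrow> real^'m^'n)"
  by (auto intro!: linearI simp: transpose_def vec_eq_iff)

lemmas transpose_simps = linear_add[OF linear_transpose] linear_diff[OF linear_transpose]
  linear_neg[OF linear_transpose] linear_cmul[OF linear_transpose] linear_0[OF linear_transpose]

lemmas mm_simps = mm.add_left mm.add_right mm.diff_left mm.diff_right mm.minus_left mm.minus_right
  mm.scaleR_left mm.scaleR_right matrix_mul_assoc[symmetric]

lemmas trace_simps = linear_add[OF linear_trace] linear_diff[OF linear_trace]
  linear_neg[OF linear_trace] linear_cmul[OF linear_trace] linear_0[OF linear_trace]

lemma trace_transpose: "trace (transpose M) = trace (M :: real^'n^'n)"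
  by (simp add: trace_def transpose_def)

text \<open>The diagonal entries of \<open>M ** A ** transpose M\<close> are the values of the
  quadratic form of \<open>A\<close> at the rows of \<open>M\<close>, which reduces the trace
  estimates below to estimates for single rows.\<close>

lemma trace_mult_transpose_rows:
  fixes A :: "real^'n^'n" and M :: "real^'n^'m"
  shows "trace (M ** A ** transpose M) = (\<Sum>i\<in>UNIV. M $ i \<bullet> (A *v M $ i))"
proof -
  have "(\<Sum>k\<in>UNIV. (\<Sum>l\<in>UNIV. M $ i $ l * A $ l $ k) * M $ i $ k) = M $ i \<bullet> (A *v M $ i)" for i
    unfolding matrix_vector_mult_def inner_vec_def sum_distrib_right
    by (subst sum.swap) (simp add: sum_distrib_left mult_ac)
  then show ?thesis by (simp add: trace_def matrix_matrix_mult_def transpose_def)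
qed

lemma norm_sq_matrix: "(norm (M :: real^'n^'m))\<^sup>2 = (\<Sum>i\<in>UNIV. M $ i \<bullet> M $ i)"
  by (simp add: power2_norm_eq_inner inner_vec_def)

lemma SPD_transpose: "A \<in> SPD \<Longrightarrow> transpose A = A"
  by (simp add: SPD_def Sym_def)

lemma inner_symmetric_matrix: "transpose A = A \<Longrightarrow> x \<bullet> (A *v y) = (A *v x) \<bullet> (y :: real^'n)"
  by (metis dot_lmul_matrix transpose_matrix_vector)

lemma SPD_nonneg: "A \<in> SPD \<Longrightarrow> x \<bullet> (A *v x) \<ge> 0"
  unfolding SPD_def by (cases "x = 0") (auto simp: less_imp_le)

lemma SPD_trace_pos:
  fixes M :: "real^'n^'m"
  assumes "A \<in> SPD" "M \<noteq> 0"
  shows "trace (M ** A ** transpose M) > 0"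
proof -
  obtain i where "M $ i \<noteq> 0" using assms(2) by (auto simp: vec_eq_iff)
  then have "M $ i \<bullet> (A *v M $ i) > 0" using assms(1) by (auto simp: SPD_def)
  then show ?thesis unfolding trace_mult_transpose_rows
    using SPD_nonneg[OF assms(1)] by (intro sum_pos2[of _ i]) auto
qed

lemma SPD_trace_nonneg:
  "A \<in> SPD \<Longrightarrow> trace (M ** A ** transpose M) \<ge> 0"
  by (simp add: trace_mult_transpose_rows SPD_nonneg sum_nonneg)

lemma subspace_Sym: "subspace Sym"
  by (auto simp: subspace_def Sym_def transpose_simps)

section \<open>The Sylvester operator\<close>

text \<open>Pairing the equation with \<open>transpose S\<close> under the trace gives a sum of two
  nonnegative trace forms, one of which is positive unless \<open>S = 0\<close>.\<close>

lemma sylv_unique_zero: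
  assumes A: "A \<in> SPD" and S: "A ** S + S ** A = 0"
  shows "S = 0"
proof (rule ccontr)
  assume "S \<noteq> 0"
  then have "trace (S ** A ** transpose S) > 0" by (rule SPD_trace_pos[OF A])
  moreover have "trace (transpose S ** A ** S) \<ge> 0"
    using SPD_trace_nonneg[OF A, of "transpose S"] by simp
  moreover have "trace (transpose S ** (A ** S + S ** A)) = trace (transpose S ** A ** S) + trace (S ** A ** transpose S)"
    by (simp add: mm_simps trace_simps trace_mul_sym[of "transpose S"])
  ultimately show False by (simp add: S mm.zero_right trace_simps)
qed

lemma sylv_ex1:
  assumes A: "A \<in> SPD"
  shows "\<exists>!S. A ** S + S ** A = X"
proof -
  define L where "L = (\<lambda>S. A ** S + S ** A)"
  have lin: "linear L" unfolding L_def by (auto intro!: linearI simp: mm_simps algebra_simps)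
  have inj: "inj L"
    unfolding linear_injective_0[OF lin] unfolding L_def using sylv_unique_zero[OF A] by blast
  then have "surj L" using linear_injective_imp_surjective[OF lin] by simp
  then obtain S where "L S = X" by (metis surjD)
  then have "\<exists>!S. L S = X" using inj by (auto dest: injD)
  then show ?thesis by (simp add: L_def)
qed

lemma sylv_eq: "A \<in> SPD \<Longrightarrow> A ** sylv A X + sylv A X ** A = X"
  unfolding sylv_def by (rule theI'[OF sylv_ex1])

lemma sylv_eqI: "A \<in> SPD \<Longrightarrow> A ** S + S ** A = X \<Longrightarrow> sylv A X = S"
  using sylv_ex1 sylv_eq by metis

lemma linear_sylv: assumes "A \<in> SPD" shows "linear (sylv A)"
proof (rule linearI)
  show "sylv A (X + Y) = sylv A X + sylv A Y" for X Y
    using sylv_eq[OF assms, of X] sylv_eq[OF assms, of Y]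
    by (intro sylv_eqI[OF assms]) (simp add: mm_simps algebra_simps)
  show "sylv A (c *\<^sub>R X) = c *\<^sub>R sylv A X" for c X
    using sylv_eq[OF assms, of X]
    by (intro sylv_eqI[OF assms]) (simp add: mm_simps flip: scaleR_add_right)
qed

lemmas sylv_simps = linear_add[OF linear_sylv] linear_diff[OF linear_sylv]
  linear_neg[OF linear_sylv] linear_cmul[OF linear_sylv] linear_0[OF linear_sylv]

lemma sylv_transpose: "A \<in> SPD \<Longrightarrow> transpose (sylv A X) = sylv A (transpose X)"
proof (intro sylv_eqI[symmetric])
  assume A: "A \<in> SPD"
  have "transpose (A ** sylv A X + sylv A X ** A) = transpose X" by (simp only: sylv_eq[OF A])
  then show "A ** transpose (sylv A X) + transpose (sylv A X) ** A = transpose X"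
    by (simp add: SPD_transpose[OF A] matrix_transpose_mul transpose_simps add.commute)
qed

lemma sylv_Sym: "A \<in> SPD \<Longrightarrow> X \<in> Sym \<Longrightarrow> transpose (sylv A X) = sylv A X"
  by (simp add: sylv_transpose Sym_def)

lemma sylv_cancel: "A \<in> SPD \<Longrightarrow> sylv A (A ** S + S ** A) = S"
  by (rule sylv_eqI) auto

text \<open>With \<open>X = A ** S + S ** A\<close>, the two halves of \<open>trace (T ** X)\<close>
  agree, because transposition preserves the trace and reverses a product of symmetric factors. In
  this form the base point enters through a single factor, which makes the metric easy to
  differentiate.\<close>

lemma gW_half:
  assumes "A \<in> SPD" "X \<in> Sym" "Y \<in> Sym"
  shows "gW A X Y = trace (sylv A Y ** X) / 2"
proof -
  define S T where "S = sylv A X" and "T = sylv A Y"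
  have st: "transpose S = S" "transpose T = T" by (auto simp: S_def T_def sylv_Sym assms)
  have X: "X = A ** S + S ** A" using sylv_eq[OF assms(1)] by (simp add: S_def)
  have "trace (T ** (S ** A)) = trace (T ** (A ** S))"
    using trace_transpose[of "T ** (S ** A)"] trace_mul_sym[of "A ** S" T]
    by (simp add: matrix_transpose_mul st SPD_transpose[OF assms(1)])
  then show ?thesis
    unfolding gW_def S_def[symmetric] T_def[symmetric] by (subst X) (simp add: mm_simps trace_simps)
qed

lemma bilinear_gW: assumes "A \<in> SPD" shows "bilinear (gW A)"
  unfolding bilinear_def gW_def
  by (auto intro!: linearI simp: sylv_simps[OF assms] mm_simps trace_simps)

lemma gW_commute:
  assumes "A \<in> SPD" "X \<in> Sym" "Y \<in> Sym" shows "gW A X Y = gW A Y X"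
  using trace_transpose[of "sylv A Y ** A ** sylv A X"]
  by (simp add: gW_def matrix_transpose_mul sylv_Sym assms SPD_transpose[OF assms(1)] matrix_mul_assoc)

lemma gW_pos:
  assumes "A \<in> SPD" "X \<in> Sym" "X \<noteq> 0" shows "gW A X X > 0"
proof -
  have "sylv A X \<noteq> 0" using sylv_eq[OF assms(1), of X] assms(3) by (auto simp: mm.zero_left mm.zero_right)
  from SPD_trace_pos[OF assms(1) this] show ?thesis by (simp add: gW_def sylv_Sym assms)
qed

section \<open>The minimal eigenvalue\<close>

text \<open>The Rayleigh quotient attains its minimum on the unit sphere, the minimizer is an
  eigenvector, and every eigenvalue is a value of the quotient, so the minimum is the least
  eigenvalue.\<close>

lemma lambda_min_Rayleigh:
  fixes A :: "real^'n^'n"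
  assumes "A \<in> SPD"
  shows "lambda_min A > 0" "lambda_min A * (x \<bullet> x) \<le> x \<bullet> (A *v x)"
proof -
  have At: "transpose A = A" using assms by (rule SPD_transpose)
  define q where "q = (\<lambda>x. x \<bullet> (A *v x))"
  have "compact (sphere (0::real^'n) 1)" "sphere (0::real^'n) 1 \<noteq> {}" by auto
  moreover have "continuous_on (sphere (0::real^'n) 1) q" unfolding q_def
    by (intro continuous_intros)
  ultimately obtain x0 where x0: "norm x0 = 1" "\<And>x. norm x = 1 \<Longrightarrow> q x0 \<le> q x"
    using continuous_attains_inf[of "sphere (0::real^'n) 1" q] by auto
  define l where "l = q x0"
  have "x0 \<noteq> 0" using x0(1) by auto
  then have lpos: "l > 0" unfolding l_def q_def using assms by (auto simp: SPD_def)
  have ray: "l * (x \<bullet> x) \<le> q x" for x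
  proof (cases "x = 0")
    case False
    have "q x0 \<le> q (x /\<^sub>R norm x)" using False by (intro x0(2)) simp
    also have "\<dots> = q x / (norm x)\<^sup>2"
      by (simp add: q_def matrix_vector_mult_scaleR power2_eq_square field_simps)
    finally show ?thesis using False
      by (simp add: l_def power2_norm_eq_inner field_simps)
  qed (simp add: q_def)
  define w where "w = A *v x0 - l *\<^sub>R x0"
  have "w = 0"
  proof (rule ccontr)
    assume w: "w \<noteq> 0"
    define c where "c = q w - l * (w \<bullet> w)"
    \<comment> \<open>First variation at \<open>x0\<close> in the direction of the residual
      \<open>w\<close>: the right side is \<open>q x - l * (x \<bullet> x)\<close> at
      \<open>x = x0 + t *\<^sub>R w\<close>.\<close>
    have ineq: "0 \<le> 2 * t * (w \<bullet> w) + t\<^sup>2 * c" for t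
    proof -
      have "A *v (x0 + t *\<^sub>R w) = A *v x0 + t *\<^sub>R (A *v w)"
        by (simp add: matrix_vector_right_distrib matrix_vector_mult_scaleR)
      moreover have "x0 \<bullet> (A *v w) = (A *v x0) \<bullet> w" by (rule inner_symmetric_matrix[OF At])
      ultimately have "q (x0 + t *\<^sub>R w) = q x0 + 2 * t * ((A *v x0) \<bullet> w) + t\<^sup>2 * q w"
        by (simp add: q_def algebra_simps inner_commute power2_eq_square)
      moreover have "(x0 + t *\<^sub>R w) \<bullet> (x0 + t *\<^sub>R w) = 1 + 2 * t * (x0 \<bullet> w) + t\<^sup>2 * (w \<bullet> w)"
        using x0(1) by (simp add: algebra_simps inner_commute power2_eq_square norm_eq_1)
      moreover have *: "(A *v x0) \<bullet> w - l * (x0 \<bullet> w) = w \<bullet> w"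
        by (simp add: w_def algebra_simps)
      ultimately have "0 \<le> 2 * t * ((A *v x0) \<bullet> w - l * (x0 \<bullet> w)) + t\<^sup>2 * c"
        using ray[of "x0 + t *\<^sub>R w"] by (simp add: l_def[symmetric] c_def algebra_simps)
      then show ?thesis unfolding * .
    qed
    have ww: "w \<bullet> w > 0" using w by simp
    have c0: "c \<ge> 0" using ray[of w] by (simp add: c_def)
    \<comment> \<open>The quadratic in \<open>t\<close> would be least at
      \<open>- (w \<bullet> w) / c\<close>; the denominator \<open>c + 1\<close> also covers
      \<open>c = 0\<close> and still gives a negative value.\<close>
    define t where "t = - (w \<bullet> w) / (c + 1)"
    have td: "t * (c + 1) = - (w \<bullet> w)" using c0 by (simp add: t_def)
    have "0 \<le> (2 * t * (w \<bullet> w) + t\<^sup>2 * c) * (c + 1)\<^sup>2"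
      using ineq[of t] by simp
    also have "\<dots> = 2 * (t * (c + 1)) * (w \<bullet> w) * (c + 1) + (t * (c + 1))\<^sup>2 * c"
      by (simp add: algebra_simps power2_eq_square)
    also have "\<dots> = - ((w \<bullet> w)\<^sup>2 * (c + 2))"
      unfolding td by (simp add: algebra_simps power2_eq_square)
    also have "\<dots> < 0" using ww c0 by simp
    finally show False by simp
  qed
  then have ev: "A *v x0 = l *\<^sub>R x0" by (simp add: w_def)
  have "lambda_min A = l" unfolding lambda_min_def
  proof (rule Least_equality)
    show "\<exists>v. v \<noteq> 0 \<and> A *v v = l *\<^sub>R v" using ev x0(1) by (intro exI[of _ x0]) auto
    fix y assume "\<exists>v. v \<noteq> 0 \<and> A *v v = y *\<^sub>R v"
    then obtain v where v: "v \<noteq> 0" "A *v v = y *\<^sub>R v" by blast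
    then show "l \<le> y" using ray[of v] by (simp add: q_def)
  qed
  then show "lambda_min A > 0" "lambda_min A * (x \<bullet> x) \<le> x \<bullet> (A *v x)"
    using lpos ray by (auto simp: q_def)
qed

section \<open>The Levi-Civita connection\<close>

text \<open>Openness of \<open>SPD\<close> in \<open>Sym\<close>, in the form that directional
  derivatives need. The perturbation changes the quadratic form by at most
  \<open>\<bar>t\<bar> * B * (x \<bullet> x)\<close>, which the Rayleigh bound absorbs.\<close>

lemma SPD_eventually_line:
  assumes A: "A \<in> SPD" and X: "X \<in> Sym"
  shows "\<forall>\<^sub>F t in nhds (0::real). A + t *\<^sub>R X \<in> SPD"
proof -
  obtain B where B: "B > 0" "\<And>x. norm (X *v x) \<le> B * norm x"
    using linear_bounded_pos[OF matrix_vector_mul_linear[of X]] by auto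
  have l: "lambda_min A > 0" by (rule lambda_min_Rayleigh[OF A])
  have "A + t *\<^sub>R X \<in> SPD" if t: "\<bar>t\<bar> < lambda_min A / B" for t
  proof -
    have "x \<bullet> ((A + t *\<^sub>R X) *v x) > 0" if "x \<noteq> 0" for x
    proof -
      have "\<bar>x \<bullet> (X *v x)\<bar> \<le> norm x * (B * norm x)"
        by (rule order_trans[OF Cauchy_Schwarz_ineq2]) (simp add: B mult_left_mono)
      then have "\<bar>t * (x \<bullet> (X *v x))\<bar> \<le> \<bar>t\<bar> * (norm x * (B * norm x))"
        by (simp add: abs_mult mult_left_mono)
      also have "\<dots> = (\<bar>t\<bar> * B) * (x \<bullet> x)"
        by (simp add: power2_norm_eq_inner[symmetric] power2_eq_square)
      also have "\<dots> < lambda_min A * (x \<bullet> x)"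
        using t B(1) \<open>x \<noteq> 0\<close> by (intro mult_strict_right_mono) (auto simp: field_simps)
      also have "\<dots> \<le> x \<bullet> (A *v x)" by (rule lambda_min_Rayleigh[OF A])
      finally show ?thesis
        by (simp add: matrix_vector_mult_add_rdistrib inner_add_right scaleR_matrix_vector_assoc[symmetric])
    qed
    moreover have "A + t *\<^sub>R X \<in> Sym"
      using A X subspace_Sym by (auto simp: SPD_def intro!: subspace_add subspace_scale)
    ultimately show ?thesis by (simp add: SPD_def)
  qed
  moreover have "\<forall>\<^sub>F t in nhds (0::real). \<bar>t\<bar> < lambda_min A / B"
    using eventually_nhds_metric[of _ "0::real"] l B(1)
    by (auto simp: dist_real_def intro!: exI[of _ "lambda_min A / B"])
  ultimately show ?thesis by (auto elim: eventually_mono)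
qed

text \<open>Implicit differentiation of the Sylvester equation. The exact identity \<open>fS\<close>
  first bounds \<open>f\<close> near 0 and then, applied once more, leaves a remainder of second
  order, so continuity of \<open>f\<close> need not be known beforehand.\<close>

lemma sylv_has_vector_derivative:
  assumes A: "A \<in> SPD" and X: "X \<in> Sym"
  shows "((\<lambda>t. sylv (A + t *\<^sub>R X) Y) has_vector_derivative
           - sylv A (X ** sylv A Y + sylv A Y ** X)) (at 0)"
proof -
  define \<Phi> where "\<Phi> = (\<lambda>Z. sylv A (X ** Z + Z ** X))"
  define f where "f = (\<lambda>t. sylv (A + t *\<^sub>R X) Y)"
  define S where "S = sylv A Y"
  have lin: "linear \<Phi>" unfolding \<Phi>_def
    by (auto intro!: linearI simp: mm_simps sylv_simps[OF A] algebra_simps)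
  obtain B where B: "B > 0" "\<And>x. norm (\<Phi> x) \<le> B * norm x"
    using linear_bounded_pos[OF lin] by auto
  have fS: "f t - S = - t *\<^sub>R \<Phi> (f t)" if t: "A + t *\<^sub>R X \<in> SPD" for t
  proof -
    have "A ** (f t - S) + (f t - S) ** A
       = ((A + t *\<^sub>R X) ** f t + f t ** (A + t *\<^sub>R X)) - (A ** S + S ** A)
           - t *\<^sub>R (X ** f t + f t ** X)"
      by (simp add: mm_simps algebra_simps)
    also have "\<dots> = - t *\<^sub>R (X ** f t + f t ** X)"
      unfolding f_def S_def sylv_eq[OF A] sylv_eq[OF t] by simp
    finally have "sylv A (- t *\<^sub>R (X ** f t + f t ** X)) = f t - S"
      by (intro sylv_eqI[OF A])
    then show ?thesis by (simp add: sylv_simps[OF A] \<Phi>_def)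
  qed
  have ev: "\<forall>\<^sub>F t in at 0. A + t *\<^sub>R X \<in> SPD"
    using SPD_eventually_line[OF A X] by (simp add: eventually_nhds_conv_at)
  \<comment> \<open>This threshold makes \<open>\<bar>t\<bar> * B\<close> at most 1/2, so that half
    of \<open>norm (f t)\<close> can be absorbed and \<open>norm (f t)\<close> is at most twice
    \<open>norm S\<close>.\<close>
  have "\<forall>\<^sub>F t in at (0::real). \<bar>t\<bar> < 1 / (2 * B)"
    using B(1) by (auto simp: eventually_at intro!: exI[of _ "1 / (2 * B)"])
  with ev have "\<forall>\<^sub>F h in at 0. norm (norm (f (0 + h) - f 0 - h *\<^sub>R (- \<Phi> S)) / norm h)
     \<le> \<bar>h\<bar> * (2 * B\<^sup>2 * norm S)"
  proof eventually_elim
    case (elim h)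
    have "norm (f h - S) \<le> \<bar>h\<bar> * (B * norm (f h))"
      using B(2)[of "f h"] unfolding fS[OF elim(1)] by (simp add: mult_left_mono)
    then have 1: "norm (f h - S) \<le> (\<bar>h\<bar> * B) * norm (f h)" by simp
    also have "\<dots> \<le> 1 / 2 * norm (f h)"
      using elim(2) B(1) by (intro mult_right_mono) (auto simp: field_simps)
    finally have "norm (f h) \<le> 2 * norm S"
      using norm_triangle_ineq[of "f h - S" S] by simp
    then have "(\<bar>h\<bar> * B) * norm (f h) \<le> (\<bar>h\<bar> * B) * (2 * norm S)"
      using B(1) by (intro mult_left_mono) auto
    with 1 have 2: "norm (f h - S) \<le> \<bar>h\<bar> * (2 * B * norm S)" by (simp add: mult_ac)
    \<comment> \<open>The first-order error is again \<open>\<Phi>\<close> applied to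
      \<open>f h - S\<close>, which is itself of order \<open>h\<close> by the previous
      bound.\<close>
    have "f h - S + h *\<^sub>R \<Phi> S = - h *\<^sub>R \<Phi> (f h - S)"
      unfolding linear_diff[OF lin] using fS[OF elim(1)] by (simp add: algebra_simps)
    then have "norm (f h - S + h *\<^sub>R \<Phi> S) \<le> \<bar>h\<bar> * (B * norm (f h - S))"
      using B(2)[of "f h - S"] by (simp add: mult_left_mono)
    also have "\<dots> \<le> \<bar>h\<bar> * (B * (\<bar>h\<bar> * (2 * B * norm S)))"
      using 2 B(1) by (intro mult_left_mono) auto
    finally have "norm (f h - S + h *\<^sub>R \<Phi> S) \<le> (\<bar>h\<bar> * (2 * B\<^sup>2 * norm S)) * \<bar>h\<bar>"
      by (simp add: power2_eq_square mult_ac)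
    moreover have "f 0 = S" by (simp add: f_def S_def)
    ultimately show ?case by (cases "h = 0") (auto simp: divide_le_eq B)
  qed
  moreover have "((\<lambda>h. \<bar>h\<bar> * (2 * B\<^sup>2 * norm S)) \<longlongrightarrow> 0) (at (0::real))"
    by (auto intro!: tendsto_eq_intros)
  ultimately have "((\<lambda>h. norm (f (0 + h) - f 0 - h *\<^sub>R (- \<Phi> S)) / norm h) \<longlongrightarrow> 0) (at 0)"
    by (rule Lim_null_comparison)
  then have "(f has_vector_derivative - \<Phi> S) (at 0)"
    unfolding has_vector_derivative_def has_derivative_at
    by (rule conjI[OF bounded_linear_scaleR_left])
  then show ?thesis by (simp add: f_def \<Phi>_def S_def)
qed

definition christoffel :: "real^'n^'n \<Rightarrow> real^'n^'n \<Rightarrow> real^'n^'n \<Rightarrow> real^'n^'n" where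
  "christoffel A X Y = - (sylv A X ** A ** sylv A Y + sylv A Y ** A ** sylv A X)"

lemma christoffel_has_vector_derivative:
  fixes A X Y Z :: "real^'n^'n"
  assumes A: "A \<in> SPD" and X: "X \<in> Sym"
  defines "DY \<equiv> - sylv A (X ** sylv A Y + sylv A Y ** X)"
    and "DZ \<equiv> - sylv A (X ** sylv A Z + sylv A Z ** X)"
  shows "((\<lambda>t. christoffel (A + t *\<^sub>R X) Y Z) has_vector_derivative
    - (DY ** A ** sylv A Z + sylv A Y ** X ** sylv A Z + sylv A Y ** A ** DZ
      + (DZ ** A ** sylv A Y + sylv A Z ** X ** sylv A Y + sylv A Z ** A ** DY))) (at 0)"
proof -
  have 0: "((\<lambda>t. A + t *\<^sub>R X) has_vector_derivative X) (at 0)"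
    by (auto intro!: derivative_eq_intros)
  have 1: "((\<lambda>t. sylv (A + t *\<^sub>R X) V ** (A + t *\<^sub>R X) ** sylv (A + t *\<^sub>R X) W) has_vector_derivative
     (- sylv A (X ** sylv A V + sylv A V ** X)) ** A ** sylv A W + sylv A V ** X ** sylv A W
      + sylv A V ** A ** (- sylv A (X ** sylv A W + sylv A W ** X))) (at 0)" for V W
    by (rule has_vector_derivative_eq_rhs, rule mm.has_vector_derivative, rule mm.has_vector_derivative,
        rule sylv_has_vector_derivative[OF A X], rule 0, rule sylv_has_vector_derivative[OF A X])
       (simp add: mm_simps algebra_simps)
  show ?thesis unfolding christoffel_def DY_def DZ_def
    by (intro has_vector_derivative_minus has_vector_derivative_add 1)
qed

lemma christoffel_Sym:
  assumes "A \<in> SPD" "X \<in> Sym" "Y \<in> Sym" shows "christoffel A X Y \<in> Sym"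
  using assms by (simp add: Sym_def christoffel_def transpose_simps matrix_transpose_mul SPD_transpose
     sylv_transpose matrix_mul_assoc add.commute)

lemma anticommutator_Sym: "X \<in> Sym \<Longrightarrow> transpose T = T \<Longrightarrow> X ** T + T ** X \<in> Sym"
  by (simp add: Sym_def transpose_simps matrix_transpose_mul add.commute)

text \<open>By \<open>gW_half\<close> only the derivative of \<open>sylv\<close> is needed.
  Self-adjointness of \<open>sylv A\<close> moves it onto \<open>Y\<close>, and substituting
  \<open>X = A ** U + U ** A\<close> splits the result into the two Christoffel terms.\<close>

lemma gW_dir_deriv:
  assumes A: "A \<in> SPD" and X: "X \<in> Sym" and Y: "Y \<in> Sym" and Z: "Z \<in> Sym"
  shows "dir_deriv (\<lambda>B. gW B Y Z) A X = gW A (christoffel A X Y) Z + gW A Y (christoffel A X Z)"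
proof -
  define S T U where "S = sylv A Y" and "T = sylv A Z" and "U = sylv A X"
  have M: "X ** T + T ** X \<in> Sym" using X sylv_Sym[OF A Z] by (intro anticommutator_Sym) (auto simp: T_def)
  have "((\<lambda>t. trace (sylv (A + t *\<^sub>R X) Z ** Y) / 2) has_vector_derivative
    trace (- sylv A (X ** T + T ** X) ** Y) / 2) (at 0)" unfolding T_def
    by (intro has_vector_derivative_divide bounded_linear.has_vector_derivative[OF
        linear_trace[unfolded linear_conv_bounded_linear]]
        bounded_linear.has_vector_derivative[OF mm.bounded_linear_left] sylv_has_vector_derivative A X)
  moreover have "\<forall>\<^sub>F t in nhds 0. trace (sylv (A + t *\<^sub>R X) Z ** Y) / 2 = gW (A + t *\<^sub>R X) Y Z"
    using SPD_eventually_line[OF A X] by eventually_elim (simp add: gW_half Y Z)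
  ultimately have "((\<lambda>t. gW (A + t *\<^sub>R X) Y Z) has_vector_derivative
      trace (- sylv A (X ** T + T ** X) ** Y) / 2) (at 0)"
    by (subst (asm) has_vector_derivative_cong_ev) (auto dest: eventually_nhds_x_imp_x)
  then have "dir_deriv (\<lambda>B. gW B Y Z) A X = - (trace (sylv A (X ** T + T ** X) ** Y) / 2)"
    unfolding dir_deriv_def by (simp add: vector_derivative_at mm_simps trace_simps)
  \<comment> \<open>Symmetry of \<open>gW A\<close>, read through \<open>gW_half\<close>, says that
    \<open>sylv A\<close> is self-adjoint for the trace pairing on \<open>Sym\<close>.\<close>
  also have "\<dots> = - (trace (S ** (X ** T + T ** X)) / 2)"
    using gW_half[OF A Y M] gW_half[OF A M Y] gW_commute[OF A M Y] by (simp add: S_def)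
  also have "trace (S ** (X ** T + T ** X))
     = trace (T ** (U ** A ** S + S ** A ** U)) + trace (S ** (U ** A ** T + T ** A ** U))"
  proof -
    \<comment> \<open>Cyclic rotations bring a factor \<open>A\<close> to the front, a normal form
      in which equal traces become syntactically equal.\<close>
    have 1: "trace (P ** A) = trace (A ** P)" for P by (rule trace_mul_sym)
    have 2: "trace (P ** (A ** M)) = trace (A ** (M ** P))" for P M
      by (simp add: trace_mul_sym[of P] mm_simps)
    have 3: "trace (P ** (Q ** (A ** M))) = trace (A ** (M ** (P ** Q)))" for P Q M
      using 2[of "P ** Q" M] by (simp_all add: mm_simps)
    have 4: "trace (P ** (Q ** (R ** A))) = trace (A ** (P ** (Q ** R)))" for P Q R
      using 1[of "P ** (Q ** R)"] by (simp_all add: mm_simps)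
    have X_eq: "X = A ** U + U ** A" by (simp add: U_def sylv_eq[OF A])
    show ?thesis unfolding X_eq by (simp add: mm_simps trace_simps 1 2 3 4)
  qed
  also have "- ((trace (T ** (U ** A ** S + S ** A ** U)) + trace (S ** (U ** A ** T + T ** A ** U))) / 2)
    = trace (T ** christoffel A X Y) / 2 + trace (S ** christoffel A X Z) / 2"
    by (simp add: christoffel_def S_def T_def U_def mm.minus_right trace_simps add_divide_distrib
        del: minus_add_distrib)
  also have "\<dots> = gW A (christoffel A X Y) Z + gW A Y (christoffel A X Z)"
    using gW_half[OF A christoffel_Sym[OF A X Y] Z] gW_half[OF A christoffel_Sym[OF A X Z] Y]
      gW_commute[OF A Y christoffel_Sym[OF A X Z]]
    by (simp add: S_def T_def)
  finally show ?thesis .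
qed

lemma is_levi_civita_christoffel: "is_levi_civita Sym SPD gW christoffel"
  unfolding is_levi_civita_def
  by (auto simp: christoffel_Sym gW_dir_deriv)
     (auto simp: christoffel_def sylv_simps mm_simps algebra_simps)

text \<open>Uniqueness of the Levi-Civita connection, which pins down the value of the choice
  operator. The difference \<open>H\<close> of two such connections is symmetric in its arguments,
  while \<open>gW A (H X Y) Z\<close> is skew in \<open>Y\<close> and \<open>Z\<close>; permuting
  the three vectors shows that this form vanishes, and \<open>gW A\<close> is positive
  definite.\<close>

lemma levi_civita_eq_christoffel:
  fixes A X Y :: "real^'n^'n"
  assumes A: "A \<in> SPD" and X: "X \<in> Sym" and Y: "Y \<in> Sym"
  shows "levi_civita Sym SPD gW A X Y = christoffel A X Y"
proof -
  define G where "G = levi_civita Sym SPD (gW :: real^'n^'n \<Rightarrow> _)"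
  have "is_levi_civita Sym SPD gW G"
    unfolding G_def levi_civita_def by (rule someI[of _ christoffel]) (rule is_levi_civita_christoffel)
  note G = this[unfolded is_levi_civita_def, rule_format, OF A]
  define H where "H = (\<lambda>X Y. G A X Y - christoffel A X Y)"
  have H_Sym: "H X Y \<in> Sym" if "X \<in> Sym" "Y \<in> Sym" for X Y
    unfolding H_def using that G christoffel_Sym[OF A] by (intro subspace_diff subspace_Sym) auto
  have H_comm: "H X Y = H Y X" if "X \<in> Sym" "Y \<in> Sym" for X Y
    unfolding H_def using that G by (simp add: christoffel_def add.commute)
  have bl: "gW A (P - Q) R = gW A P R - gW A Q R" "gW A P (Q - R) = gW A P Q - gW A P R" for P Q R
    using bilinear_gW[OF A] by (simp_all add: bilinear_lsub bilinear_rsub)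
  have skew: "gW A (H X Y) Z = - gW A (H X Z) Y" if s: "X \<in> Sym" "Y \<in> Sym" "Z \<in> Sym" for X Y Z
  proof -
    have "gW A (G A X Y) Z + gW A Y (G A X Z) = gW A (christoffel A X Y) Z + gW A Y (christoffel A X Z)"
      using G s gW_dir_deriv[OF A s] by simp
    then show ?thesis using gW_commute[OF A s(2) H_Sym[OF s(1) s(3)]]
      by (simp add: H_def bl)
  qed
  have zero: "gW A (H X Y) Z = 0" if "Z \<in> Sym" for Z
    using skew[OF X Y that, unfolded H_comm[OF X that]] skew[OF that X Y, unfolded H_comm[OF that Y]]
      skew[OF Y that X, unfolded H_comm[OF Y X]] by linarith
  have "H X Y = 0"
    using zero[OF H_Sym[OF X Y]] gW_pos[OF A H_Sym[OF X Y]] by force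
  then show ?thesis by (simp add: H_def G_def)
qed

section \<open>The curvature form\<close>

text \<open>
  In the application \<open>S = \<Gamma>\<^sub>A[X]\<close>, \<open>T = \<Gamma>\<^sub>A[Y]\<close>, \<open>Q = \<Gamma>\<^sub>A[T A T]\<close> and \<open>Q2 = \<Gamma>\<^sub>A[S A T + T A S]\<close>. Then \<open>P\<close>,
  \<open>P'\<close> and \<open>P2\<close> are \<open>\<Gamma>\<^sub>A[X T + T X]\<close>, \<open>\<Gamma>\<^sub>A[Y S + S Y]\<close> and \<open>\<Gamma>\<^sub>A[Y T + T Y]\<close>, the negated derivatives of \<open>T\<close>
  along \<open>X\<close>, of \<open>S\<close> along \<open>Y\<close> and of \<open>T\<close> along \<open>Y\<close>.
\<close>

lemma curvature_trace_identity:
  fixes A S T N Q Q2 :: "real^'n^'n"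
  defines "K \<equiv> S ** T - T ** S"
  defines "W \<equiv> S ** T + T ** S"
  defines "P \<equiv> (1/2) *\<^sub>R W + Q2 + (1/2) *\<^sub>R N" and "P' \<equiv> (1/2) *\<^sub>R W + Q2 - (1/2) *\<^sub>R N"
      and "P2 \<equiv> T ** T + 2 *\<^sub>R Q"
  assumes N: "A ** N + N ** A = A ** K - K ** A"
  shows "trace (S ** (2 *\<^sub>R (P ** A ** T + T ** A ** P - T ** (A ** S + S ** A) ** T)
      + 2 *\<^sub>R (S ** A ** Q + Q ** A ** S)
      - (P' ** A ** T + T ** A ** P' + S ** A ** P2 + P2 ** A ** S
         - S ** (A ** T + T ** A) ** T - T ** (A ** T + T ** A) ** S)
      - (T ** A ** Q2 + Q2 ** A ** T))) / 2
    = 3 / 4 * (- trace (K ** A ** K) - trace (N ** A ** N))"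
proof -
  have 1: "trace (P ** A) = trace (A ** P)" for P by (rule trace_mul_sym)
  have 2: "trace (P ** (A ** M)) = trace (A ** (M ** P))" for P M
    by (simp add: trace_mul_sym[of P] mm_simps)
  have 3: "trace (P ** (Q ** (A ** M))) = trace (A ** (M ** (P ** Q)))"
          "trace (P ** (Q ** A)) = trace (A ** (P ** Q))" for P Q M
    using 2[of "P ** Q" M] 1[of "P ** Q"] by (simp_all add: mm_simps)
  have 4: "trace (P ** (Q ** (R ** (A ** M)))) = trace (A ** (M ** (P ** (Q ** R))))"
          "trace (P ** (Q ** (R ** A))) = trace (A ** (P ** (Q ** R)))" for P Q R M
    using 2[of "P ** (Q ** R)" M] 1[of "P ** (Q ** R)"] by (simp_all add: mm_simps)
  have 5: "trace (P ** (Q ** (R ** (U ** A)))) = trace (A ** (P ** (Q ** (R ** U))))" for P Q R U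
    using 1[of "P ** (Q ** (R ** U))"] by (simp_all add: mm_simps)
  note n = mm_simps trace_simps 1 2 3 4 5
  \<comment> \<open>The equation for \<open>N\<close> enters only through its trace pairings with
    \<open>W\<close> (\<open>f1\<close>) and with \<open>N\<close> itself
    (\<open>f2\<close>).\<close>
  have "trace ((A ** N + N ** A) ** W) = trace ((A ** K - K ** A) ** W)" by (simp only: N)
  then have f1: "trace (A ** (N ** (S ** T))) + trace (A ** (N ** (T ** S)))
     + trace (A ** (S ** (T ** N))) + trace (A ** (T ** (S ** N)))
    = 2 * trace (A ** (S ** (T ** (T ** S)))) - 2 * trace (A ** (T ** (S ** (S ** T))))"
    by (simp add: n W_def K_def)
  have "trace (N ** (A ** N + N ** A)) = trace (N ** (A ** K - K ** A))" by (simp only: N)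
  then have f2: "2 * trace (A ** (N ** N)) = trace (A ** (S ** (T ** N))) - trace (A ** (T ** (S ** N)))
     - (trace (A ** (N ** (S ** T))) - trace (A ** (N ** (T ** S))))"
    by (simp add: n K_def)
  \<comment> \<open>The terms in \<open>Q\<close> and \<open>Q2\<close> cancel identically, so no
    equation for these two matrices is assumed.\<close>
  show ?thesis using f1 f2
    unfolding K_def W_def P_def P'_def P2_def by (simp only: n real_scaleR_def) argo
qed

text \<open>The form is \<open>trace (E ** A ** transpose E)\<close> for \<open>E = N + K\<close>:
  pairing the equation for \<open>N\<close> with \<open>N\<close> shows that the cross terms
  contribute \<open>- 2 * trace (N ** A ** N)\<close>. A vanishing \<open>E\<close> would make its
  skew part \<open>K\<close> vanish.\<close>

lemma curvature_form_pos:
  fixes A K N :: "real^'n^'n"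
  assumes A: "A \<in> SPD" and K: "transpose K = - K" "K \<noteq> 0" and Nt: "transpose N = N"
    and N: "A ** N + N ** A = A ** K - K ** A"
  shows "- trace (K ** A ** K) - trace (N ** A ** N) > 0"
proof -
  have "N + K \<noteq> 0"
  proof
    assume NK: "N + K = 0"
    then have "transpose (N + K) = 0" by (simp add: transpose_simps)
    then have "N - K = 0" by (simp add: transpose_simps K Nt)
    then have "K + K = 0" using NK by simp
    then have "2 *\<^sub>R K = 0" by (simp add: scaleR_2)
    then show False using K by simp
  qed
  from SPD_trace_pos[OF A this]
  have "0 < trace ((N + K) ** A ** (N - K))" by (simp add: transpose_simps K Nt)
  moreover have "trace (P ** A) = trace (A ** P)" "trace (P ** (A ** M)) = trace (A ** (M ** P))"
    "trace (P ** (M ** A)) = trace (A ** (P ** M))" for P M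
    using trace_mul_sym[of P] trace_mul_sym[of "P ** M" A] by (simp_all add: mm_simps)
  note n = mm_simps trace_simps this
  moreover have "trace (N ** (A ** N + N ** A)) = trace (N ** (A ** K - K ** A))" by (simp only: N)
  ultimately show ?thesis by (simp add: n)
qed

section \<open>Strict upper bound for the commutator form\<close>

text \<open>Lagrange's identity for a quadratic form. It writes the defect in the Cauchy-Schwarz
  inequality as a sum of values of \<open>q\<close>, from which strictness can be read off.\<close>

lemma Lagrange_identity_form:
  fixes A :: "real^'n^'n" and a :: "'k::finite \<Rightarrow> real" and s :: "'k \<Rightarrow> real^'n"
  assumes A: "transpose A = A"
  defines "q \<equiv> \<lambda>x. x \<bullet> (A *v x)"
  shows "(\<Sum>k\<in>UNIV. \<Sum>l\<in>UNIV. q (a k *\<^sub>R s l - a l *\<^sub>R s k))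
    = 2 * ((\<Sum>k\<in>UNIV. (a k)\<^sup>2) * (\<Sum>k\<in>UNIV. q (s k)) - q (\<Sum>k\<in>UNIV. a k *\<^sub>R s k))"
proof -
  define b where "b = (\<lambda>x y. x \<bullet> (A *v y))"
  have b_comm: "b x y = b y x" for x y
    unfolding b_def by (subst inner_symmetric_matrix[OF A]) (rule inner_commute)
  have sum_A: "A *v (\<Sum>k\<in>UNIV. f k) = (\<Sum>k\<in>UNIV. A *v f k)" for f :: "'k \<Rightarrow> real^'n"
    by (rule linear_sum[OF matrix_vector_mul_linear])
  have qs: "q (\<Sum>k\<in>UNIV. a k *\<^sub>R s k) = (\<Sum>k\<in>UNIV. \<Sum>l\<in>UNIV. a k * a l * b (s k) (s l))"
    by (simp add: q_def b_def sum_A inner_sum_left inner_sum_right matrix_vector_mult_scaleR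
        sum_distrib_left mult_ac) (subst sum.swap, simp add: mult_ac)
  have "q (a k *\<^sub>R s l - a l *\<^sub>R s k)
     = (a k)\<^sup>2 * q (s l) + (a l)\<^sup>2 * q (s k) - 2 * (a k * a l * b (s k) (s l))" for k l
    using b_comm[of "s k" "s l"]
    by (simp add: q_def b_def matrix_vector_mult_diff_distrib matrix_vector_mult_scaleR
        inner_diff_left inner_diff_right algebra_simps power2_eq_square)
  moreover have "(\<Sum>k\<in>UNIV. \<Sum>l\<in>UNIV. (a k)\<^sup>2 * q (s l)) = (\<Sum>k\<in>UNIV. (a k)\<^sup>2) * (\<Sum>k\<in>UNIV. q (s k))"
    by (simp add: sum_product)
  moreover have "(\<Sum>k\<in>UNIV. \<Sum>l\<in>UNIV. (a l)\<^sup>2 * q (s k)) = (\<Sum>k\<in>UNIV. (a k)\<^sup>2) * (\<Sum>k\<in>UNIV. q (s k))"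
    by (subst sum.swap) (simp add: sum_product)
  ultimately have "(\<Sum>k\<in>UNIV. \<Sum>l\<in>UNIV. q (a k *\<^sub>R s l - a l *\<^sub>R s k))
    = (\<Sum>k\<in>UNIV. (a k)\<^sup>2) * (\<Sum>k\<in>UNIV. q (s k)) + (\<Sum>k\<in>UNIV. (a k)\<^sup>2) * (\<Sum>k\<in>UNIV. q (s k))
      - 2 * (\<Sum>k\<in>UNIV. \<Sum>l\<in>UNIV. a k * a l * b (s k) (s l))"
    by (simp only: sum.distrib sum_subtractf sum_distrib_left)
  then show ?thesis by (simp add: qs)
qed

text \<open>Row \<open>i\<close> of \<open>T ** S\<close> combines the rows of \<open>S\<close> with
  coefficients from row \<open>i\<close> of \<open>T\<close>, so Lagrange's identity applies to each
  row. Its defect terms are the \<open>q (D i k l)\<close>, and they cannot all vanish unless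
  \<open>S\<close> and \<open>T\<close> commute.\<close>

lemma trace_noncommuting_less:
  fixes A S T :: "real^'n^'n"
  assumes A: "A \<in> SPD" and st: "transpose S = S" "transpose T = T" and nc: "S ** T \<noteq> T ** S"
  shows "trace (T ** S ** A ** S ** T) < (norm T)\<^sup>2 * trace (S ** A ** S)"
proof -
  define q where "q = (\<lambda>x. x \<bullet> (A *v x))"
  define D where "D = (\<lambda>i k l. T $ i $ k *\<^sub>R S $ l - T $ i $ l *\<^sub>R S $ k)"
  have qn: "q x \<ge> 0" for x unfolding q_def by (rule SPD_nonneg[OF A])
  have "\<exists>i k l. D i k l \<noteq> 0"
  proof (rule ccontr)
    assume "\<not> ?thesis"
    then have "\<And>i k l. T $ i $ k *\<^sub>R S $ l = T $ i $ l *\<^sub>R S $ k" by (auto simp: D_def)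
    then have e: "T $ i $ k * S $ l $ m = T $ i $ l * S $ k $ m" for i k l m
      by (metis real_scaleR_def vector_scaleR_component)
    have sy: "S $ i $ k = S $ k $ i" "T $ i $ k = T $ k $ i" for i k
      by (metis st transpose_def vec_lambda_beta)+
    \<comment> \<open>Both sides equal \<open>T $ i $ m * S $ k $ k\<close>, by \<open>e\<close> and
      the symmetry of \<open>S\<close> and \<open>T\<close>.\<close>
    have "S $ i $ k * T $ k $ m = T $ i $ k * S $ k $ m" for i k m
      by (metis e sy mult.commute)
    then have "S ** T = T ** S" by (simp add: matrix_matrix_mult_def)
    then show False using nc by simp
  qed
  then obtain i k l where ikl: "D i k l \<noteq> 0" by blast
  then have "q (D i k l) > 0" using A by (auto simp: q_def SPD_def)
  then have "0 < (\<Sum>l\<in>UNIV. q (D i k l))" by (rule sum_pos2[rotated 2]) (auto simp: qn)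
  then have "0 < (\<Sum>k\<in>UNIV. \<Sum>l\<in>UNIV. q (D i k l))"
    by (rule sum_pos2[rotated 2]) (auto simp: qn sum_nonneg)
  then have "0 < (\<Sum>i\<in>UNIV. \<Sum>k\<in>UNIV. \<Sum>l\<in>UNIV. q (D i k l))"
    by (rule sum_pos2[rotated 2]) (auto simp: qn sum_nonneg)
  also have "\<dots> = (\<Sum>i\<in>UNIV. 2 * ((\<Sum>k\<in>UNIV. (T $ i $ k)\<^sup>2) * (\<Sum>k\<in>UNIV. q (S $ k))
                     - q (\<Sum>k\<in>UNIV. T $ i $ k *\<^sub>R S $ k)))"
    unfolding D_def q_def by (intro sum.cong refl Lagrange_identity_form SPD_transpose A)
  also have "\<dots> = 2 * ((\<Sum>i\<in>UNIV. \<Sum>k\<in>UNIV. (T $ i $ k)\<^sup>2) * (\<Sum>k\<in>UNIV. q (S $ k))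
                     - (\<Sum>i\<in>UNIV. q (\<Sum>k\<in>UNIV. T $ i $ k *\<^sub>R S $ k)))"
    by (simp only: sum_subtractf flip: sum_distrib_left sum_distrib_right)
  also have "(\<Sum>i\<in>UNIV. \<Sum>k\<in>UNIV. (T $ i $ k)\<^sup>2) = (norm T)\<^sup>2"
    unfolding norm_sq_matrix by (simp add: inner_vec_def power2_eq_square)
  also have "(\<Sum>k\<in>UNIV. q (S $ k)) = trace (S ** A ** S)"
    using trace_mult_transpose_rows[of S A] by (simp add: st q_def)
  also have "(\<Sum>i\<in>UNIV. q (\<Sum>k\<in>UNIV. T $ i $ k *\<^sub>R S $ k)) = trace (T ** S ** A ** S ** T)"
  proof -
    have "(\<Sum>k\<in>UNIV. T $ i $ k *\<^sub>R S $ k) = (T ** S) $ i" for i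
      by (simp add: matrix_matrix_mult_def vec_eq_iff)
    then show ?thesis
      using trace_mult_transpose_rows[of "T ** S" A]
      by (simp add: st q_def matrix_transpose_mul matrix_mul_assoc)
  qed
  finally show ?thesis by simp
qed

lemma lambda_min_norm_le:
  fixes A T :: "real^'n^'n"
  assumes "A \<in> SPD" "transpose T = T"
  shows "lambda_min A * (norm T)\<^sup>2 \<le> trace (T ** A ** T)"
proof -
  have "lambda_min A * (norm T)\<^sup>2 = (\<Sum>i\<in>UNIV. lambda_min A * (T $ i \<bullet> T $ i))"
    by (simp add: norm_sq_matrix sum_distrib_left)
  also have "\<dots> \<le> (\<Sum>i\<in>UNIV. T $ i \<bullet> (A *v T $ i))"
    by (intro sum_mono lambda_min_Rayleigh assms)
  finally show ?thesis using trace_mult_transpose_rows[of T A] assms by simp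
qed

text \<open>Parallelogram law: adding the form of the anticommutator, which is nonnegative, to that
  of the commutator gives twice the sum of the two traces estimated in \<open>1\<close> and
  \<open>2\<close>.\<close>

lemma commutator_form_bound:
  fixes A S T :: "real^'n^'n"
  assumes A: "A \<in> SPD" and st: "transpose S = S" "transpose T = T"
    and unit: "trace (S ** A ** S) = 1" "trace (T ** A ** T) = 1"
    and nc: "S ** T - T ** S \<noteq> 0"
  shows "- trace ((S ** T - T ** S) ** A ** (S ** T - T ** S)) < 4 / lambda_min A"
proof -
  have l: "lambda_min A > 0" by (rule lambda_min_Rayleigh[OF A])
  have "trace (T ** S ** A ** S ** T) < (norm T)\<^sup>2"
    using trace_noncommuting_less[OF A st] nc unit by simp
  also have "\<dots> \<le> 1 / lambda_min A"
    using lambda_min_norm_le[OF A st(2)] unit l by (simp add: field_simps)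
  finally have 1: "trace (T ** S ** A ** S ** T) < 1 / lambda_min A" .
  have "trace (S ** T ** A ** T ** S) < (norm S)\<^sup>2"
    using trace_noncommuting_less[OF A st(2) st(1)] nc unit by simp
  also have "\<dots> \<le> 1 / lambda_min A"
    using lambda_min_norm_le[OF A st(1)] unit l by (simp add: field_simps)
  finally have 2: "trace (S ** T ** A ** T ** S) < 1 / lambda_min A" .
  have "transpose (S ** T + T ** S) = S ** T + T ** S"
    by (simp add: transpose_simps matrix_transpose_mul st add.commute)
  then have "trace ((S ** T + T ** S) ** A ** (S ** T + T ** S)) \<ge> 0"
    using SPD_trace_nonneg[OF A, of "S ** T + T ** S"] by simp
  then have "- trace ((S ** T - T ** S) ** A ** (S ** T - T ** S))
     \<le> 2 * trace (T ** S ** A ** S ** T) + 2 * trace (S ** T ** A ** T ** S)"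
    by (simp add: mm_simps trace_simps)
  with 1 2 show ?thesis by simp
qed

section \<open>Orthonormal bases without commuting pairs\<close>

lemma independent_if_orthonormal:
  fixes h :: "'a::real_vector \<Rightarrow> 'a \<Rightarrow> real"
  assumes h: "bilinear h" and B: "finite B" "\<And>e. e \<in> B \<Longrightarrow> h e e = 1"
    "\<And>e f. e \<in> B \<Longrightarrow> f \<in> B \<Longrightarrow> e \<noteq> f \<Longrightarrow> h e f = 0"
  shows "independent B"
proof (rule independent_if_scalars_zero[OF B(1)])
  fix u e assume u: "(\<Sum>x\<in>B. u x *\<^sub>R x) = 0" and e: "e \<in> B"
  have lin: "linear (\<lambda>x. h x e)" using h by (simp add: bilinear_def)
  have "0 = h (\<Sum>x\<in>B. u x *\<^sub>R x) e" using bilinear_lzero[OF h] by (simp add: u)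
  also have "\<dots> = (\<Sum>x\<in>B. u x * h x e)"
    using linear_sum[OF lin, of "\<lambda>x. u x *\<^sub>R x" B] by (simp add: bilinear_lmul[OF h])
  also have "\<dots> = (\<Sum>x\<in>B. if x = e then u e else 0)"
    using B e by (intro sum.cong) auto
  also have "\<dots> = u e" using B(1) e by simp
  finally show "u e = 0" by simp
qed

text \<open>An orthonormal set of largest cardinality spans \<open>V\<close>: otherwise the
  normalized residual of a vector outside its span could be added.\<close>

lemma orthonormal_basis_exists:
  fixes h :: "'a::euclidean_space \<Rightarrow> 'a \<Rightarrow> real"
  assumes h: "bilinear h" and V: "subspace V"
    and comm: "\<And>x y. x \<in> V \<Longrightarrow> y \<in> V \<Longrightarrow> h x y = h y x"
    and pos: "\<And>x. x \<in> V \<Longrightarrow> x \<noteq> 0 \<Longrightarrow> h x x > 0"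
  obtains B where "orthonormal_basis_of V h B"
proof -
  define on where "on = (\<lambda>B. finite B \<and> B \<subseteq> V \<and> (\<forall>e\<in>B. h e e = 1)
     \<and> (\<forall>e\<in>B. \<forall>f\<in>B. e \<noteq> f \<longrightarrow> h e f = 0))"
  have ind: "independent B" if "on B" for B
    using that by (intro independent_if_orthonormal[OF h]) (auto simp: on_def)
  have "\<exists>B. on B \<and> (\<forall>C. on C \<longrightarrow> card C \<le> card B)"
  proof (rule ex_has_greatest_nat[of on "{}" card "Suc (dim V)"])
    show "on {}" by (simp add: on_def)
    show "\<forall>C. on C \<longrightarrow> card C < Suc (dim V)"
      using ind by (auto simp: on_def less_Suc_eq_le intro!: independent_card_le_dim)
  qed
  then obtain B where B: "on B" "\<And>C. on C \<Longrightarrow> card C \<le> card B" by blast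
  have fin: "finite B" and BV: "B \<subseteq> V" using B(1) by (auto simp: on_def)
  have "span B = V"
  proof (rule ccontr)
    assume "span B \<noteq> V"
    then obtain x where x: "x \<in> V" "x \<notin> span B" using span_minimal[OF BV V] by auto
    define p where "p = (\<Sum>b\<in>B. h x b *\<^sub>R b)"
    define y where "y = x - p"
    have pB: "p \<in> span B" unfolding p_def by (intro span_sum span_scale span_base)
    then have yV: "y \<in> V" using span_minimal[OF BV V] x V by (auto simp: y_def intro: subspace_diff)
    have y0: "y \<noteq> 0" using x pB by (auto simp: y_def)
    have yb: "h y b = 0" if b: "b \<in> B" for b
    proof -
      have lin: "linear (\<lambda>x. h x b)" using h by (simp add: bilinear_def)
      have "h p b = (\<Sum>e\<in>B. h x e * h e b)" unfolding p_def
        using linear_sum[OF lin, of "\<lambda>e. h x e *\<^sub>R e" B] by (simp add: bilinear_lmul[OF h])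
      also have "\<dots> = (\<Sum>e\<in>B. if e = b then h x b else 0)"
        using B(1) b by (intro sum.cong) (auto simp: on_def)
      also have "\<dots> = h x b" using fin b by simp
      finally show ?thesis by (simp add: y_def bilinear_lsub[OF h])
    qed
    define z where "z = (1 / sqrt (h y y)) *\<^sub>R y"
    have zV: "z \<in> V" using yV V by (simp add: z_def subspace_scale)
    have zz: "h z z = 1" using pos[OF yV y0]
      by (simp add: z_def bilinear_lmul[OF h] bilinear_rmul[OF h])
    have zb: "h z b = 0" "h b z = 0" if "b \<in> B" for b
    proof -
      show "h z b = 0" using yb[OF that] by (simp add: z_def bilinear_lmul[OF h])
      then show "h b z = 0" using comm zV BV that by auto
    qed
    have "z \<notin> B" using zz zb by force
    moreover have "on (insert z B)" using B(1) zV zz zb by (auto simp: on_def)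
    ultimately show False using B(2)[of "insert z B"] fin by simp
  qed
  then have "orthonormal_basis_of V h B"
    using B(1) ind[OF B(1)] by (auto simp: orthonormal_basis_of_def on_def)
  then show ?thesis by (rule that)
qed

text \<open>The assumption \<open>center\<close> confines the kernel of \<open>c\<close> on
  \<open>V\<close> to a line. Two distinct basis vectors cannot both lie on it, so in a commuting
  pair some member fails to commute with a third basis vector, which serves as the partner in the
  rotation.\<close>

lemma noncommuting_orthonormal_basis_exists:
  fixes h :: "'a::euclidean_space \<Rightarrow> 'a \<Rightarrow> real"
    and c :: "'a \<Rightarrow> 'a \<Rightarrow> 'b::real_normed_vector"
  assumes h: "bilinear h" and V: "subspace V"
    and comm: "\<And>x y. x \<in> V \<Longrightarrow> y \<in> V \<Longrightarrow> h x y = h y x"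
    and pos: "\<And>x. x \<in> V \<Longrightarrow> x \<noteq> 0 \<Longrightarrow> h x x > 0"
    and c: "bounded_bilinear c" and skew: "\<And>x y. c x y = - c y x"
    and center: "\<And>x. x \<in> V \<Longrightarrow> (\<And>y. y \<in> V \<Longrightarrow> c x y = 0) \<Longrightarrow> x \<in> span {z}"
  obtains B where "orthonormal_basis_of V h B" "\<And>e f. e \<in> B \<Longrightarrow> f \<in> B \<Longrightarrow> e \<noteq> f \<Longrightarrow> c e f \<noteq> 0"
proof -
  interpret c: bounded_bilinear c by (rule c)
  obtain I where I: "orthonormal_basis_of V h I"
    using orthonormal_basis_exists[OF h V comm pos] by blast
  have fin: "finite I" using I by (auto simp: orthonormal_basis_of_def independent_imp_finite)
  have cardI: "card I = dim V"
    using I by (metis dim_span_eq_card_independent orthonormal_basis_of_def)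
  \<comment> \<open>Bases are families over the fixed index set \<open>I\<close>, so that a pair
    keeps its name while its vectors are rotated.\<close>
  define on where "on = (\<lambda>e. e ` I \<subseteq> V \<and> (\<forall>i\<in>I. \<forall>j\<in>I. h (e i) (e j) = (if i = j then 1 else 0)))"
  define bad where "bad = (\<lambda>e. {(i, j). i \<in> I \<and> j \<in> I \<and> i \<noteq> j \<and> c (e i) (e j) = 0})"
  have fin_bad: "finite (bad e)" for e
    using fin by (auto simp: bad_def intro: finite_subset[of _ "I \<times> I"])
  have "on id" using I by (auto simp: on_def orthonormal_basis_of_def)
  then obtain e where e: "on e" "\<And>e'. on e' \<Longrightarrow> card (bad e) \<le> card (bad e')"
    using ex_has_least_nat[of on id "\<lambda>e. card (bad e)"] by blast
  have eV: "e i \<in> V" if "i \<in> I" for i using e(1) that by (auto simp: on_def)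
  have h_e: "h (e i) (e j) = (if i = j then 1 else 0)" if "i \<in> I" "j \<in> I" for i j
    using e(1) that by (auto simp: on_def)
  have inj: "inj_on e I"
    by (rule inj_onI) (metis h_e zero_neq_one)
  have ind: "independent (e ` I)"
    using h_e inj by (intro independent_if_orthonormal[OF h]) (auto simp: fin inj_on_def)
  have "V \<subseteq> span (e ` I)"
    using ind eV by (intro card_ge_dim_independent) (auto simp: card_image[OF inj] cardI)
  then have span: "span (e ` I) = V"
    using span_minimal[OF _ V, of "e ` I"] eV by blast
  have "bad e = {}"
  proof (rule ccontr)
    assume "bad e \<noteq> {}"
    then obtain i0 j0 where ij0: "i0 \<in> I" "j0 \<in> I" "i0 \<noteq> j0" "c (e i0) (e j0) = 0"
      by (auto simp: bad_def)
    have "\<not> (e i0 \<in> span {z} \<and> e j0 \<in> span {z})"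
    proof
      assume "e i0 \<in> span {z} \<and> e j0 \<in> span {z}"
      then obtain a b where ab: "e i0 = a *\<^sub>R z" "e j0 = b *\<^sub>R z"
        by (auto simp: span_singleton)
      show False using h_e[of i0 i0] h_e[of j0 j0] h_e[of i0 j0] ij0
        by (auto simp: ab bilinear_lmul[OF h] bilinear_rmul[OF h])
    qed
    then obtain i j where ij: "i \<in> I" "j \<in> I" "i \<noteq> j" "c (e i) (e j) = 0" "e i \<notin> span {z}"
      using ij0 skew[of "e j0" "e i0"] by force
    obtain k where k: "k \<in> I" "c (e i) (e k) \<noteq> 0"
    proof -
      have "\<exists>k\<in>I. c (e i) (e k) \<noteq> 0"
      proof (rule ccontr)
        assume "\<not> ?thesis"
        moreover have "linear (c (e i))"
          using c.bounded_linear_right bounded_linear.linear by blast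
        ultimately have "c (e i) y = 0" if "y \<in> V" for y
          using linear_eq_0_on_span[of "c (e i)" "e ` I" y] that span by auto
        then show False using center[OF eV[OF ij(1)]] ij(5) by blast
      qed
      then show ?thesis using that by blast
    qed
    have "2 *\<^sub>R c (e i) (e i) = 0"
      using skew[of "e i" "e i"] by (simp add: scaleR_2 eq_neg_iff_add_eq_0)
    then have "c (e i) (e i) = 0" by simp
    then have kij: "k \<noteq> i" "k \<noteq> j" using k ij by auto
    \<comment> \<open>Only \<open>e j\<close> and \<open>e k\<close> move. Since \<open>e i\<close>
      stays fixed and \<open>c (e i) (e j) = 0\<close>, the pair \<open>(i, j)\<close> acquires the
      value \<open>sin t *\<^sub>R c (e i) (e k)\<close>.\<close>
    define e' where "e' = (\<lambda>t. e(j := cos t *\<^sub>R e j + sin t *\<^sub>R e k, k := cos t *\<^sub>R e k - sin t *\<^sub>R e j))"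
    have on': "on (e' t)" for t
    proof -
      have sc: "cos t * cos t + sin t * sin t = 1" "sin t * sin t + cos t * cos t = 1"
        using sin_cos_squared_add3[of t] by (simp_all add: add.commute)
      have "e' t l \<in> V" if "l \<in> I" for l
        using that ij k eV V by (auto simp: e'_def intro!: subspace_add subspace_diff subspace_scale)
      moreover have "h (e' t l) (e' t m) = (if l = m then 1 else 0)" if "l \<in> I" "m \<in> I" for l m
        using that ij k kij sc
        by (auto simp: e'_def h_e bilinear_ladd[OF h] bilinear_radd[OF h] bilinear_lsub[OF h]
            bilinear_rsub[OF h] bilinear_lmul[OF h] bilinear_rmul[OF h])
      ultimately show ?thesis by (auto simp: on_def)
    qed
    have lim: "((\<lambda>t. e' t l) \<longlongrightarrow> e l) (at 0)" for l
      unfolding e'_def using kij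
      by (cases "l = k"; cases "l = j") (auto intro!: tendsto_eq_intros)
    \<comment> \<open>By continuity, each of the finitely many noncommuting pairs stays noncommuting
      for small angles.\<close>
    have "\<forall>\<^sub>F t in at 0. \<forall>p\<in>I \<times> I. c (e (fst p)) (e (snd p)) \<noteq> 0 \<longrightarrow> c (e' t (fst p)) (e' t (snd p)) \<noteq> 0"
    proof (rule eventually_ball_finite)
      show "finite (I \<times> I)" using fin by simp
      show "\<forall>p\<in>I \<times> I. \<forall>\<^sub>F t in at 0. c (e (fst p)) (e (snd p)) \<noteq> 0 \<longrightarrow> c (e' t (fst p)) (e' t (snd p)) \<noteq> 0"
        using tendsto_imp_eventually_ne[OF c.tendsto[OF lim lim]]
        by (auto intro: eventually_mono)
    qed
    moreover have "\<forall>\<^sub>F t in at (0::real). sin t \<noteq> 0"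
      unfolding eventually_at
      by (intro exI[of _ pi]) (auto simp: dist_real_def sin_eq_0_pi)
    ultimately have "\<forall>\<^sub>F t in at (0::real). sin t \<noteq> 0 \<and> (\<forall>p\<in>I \<times> I. c (e (fst p)) (e (snd p)) \<noteq> 0 \<longrightarrow> c (e' t (fst p)) (e' t (snd p)) \<noteq> 0)"
      by eventually_elim auto
    then obtain t where t: "sin t \<noteq> 0"
       "\<And>l m. l \<in> I \<Longrightarrow> m \<in> I \<Longrightarrow> c (e l) (e m) \<noteq> 0 \<Longrightarrow> c (e' t l) (e' t m) \<noteq> 0"
      using eventually_happens'[OF at_neq_bot] by fastforce
    have "c (e' t i) (e' t j) \<noteq> 0"
      using ij k kij t(1) by (simp add: e'_def c.add_right c.scaleR_right)
    then have "(i, j) \<in> bad e" "(i, j) \<notin> bad (e' t)" using ij by (auto simp: bad_def)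
    moreover have "bad (e' t) \<subseteq> bad e" using t(2) by (auto simp: bad_def)
    ultimately have "bad (e' t) \<subset> bad e" by blast
    then have "card (bad (e' t)) < card (bad e)" by (rule psubset_card_mono[OF fin_bad])
    then show False using e(2)[OF on'[of t]] by simp
  qed
  then have "\<And>x y. x \<in> e ` I \<Longrightarrow> y \<in> e ` I \<Longrightarrow> x \<noteq> y \<Longrightarrow> c x y \<noteq> 0"
    by (auto simp: bad_def)
  moreover have "orthonormal_basis_of V h (e ` I)"
    using ind span eV h_e inj by (auto simp: orthonormal_basis_of_def inj_on_def)
  ultimately show ?thesis using that by blast
qed

section \<open>Sectional curvature of the Wasserstein metric\<close>

lemma dir_deriv_const: "dir_deriv (\<lambda>_. c) A X = 0"
  by (simp add: dir_deriv_def)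

lemma dir_deriv_levi_civita:
  fixes A X Y Z :: "real^'n^'n"
  assumes A: "A \<in> SPD" and X: "X \<in> Sym" and Y: "Y \<in> Sym" and Z: "Z \<in> Sym"
  defines "PY \<equiv> sylv A (X ** sylv A Y + sylv A Y ** X)"
    and "PZ \<equiv> sylv A (X ** sylv A Z + sylv A Z ** X)"
  shows "dir_deriv (\<lambda>B. levi_civita Sym SPD gW B Y Z) A X
   = PY ** A ** sylv A Z + sylv A Z ** A ** PY + sylv A Y ** A ** PZ + PZ ** A ** sylv A Y
      - sylv A Y ** X ** sylv A Z - sylv A Z ** X ** sylv A Y"
proof -
  \<comment> \<open>The two connections are known to agree only at points of \<open>SPD\<close>,
    which suffices because the line stays there for small \<open>t\<close>.\<close>
  have "\<forall>\<^sub>F t in nhds 0. christoffel (A + t *\<^sub>R X) Y Z = levi_civita Sym SPD gW (A + t *\<^sub>R X) Y Z"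
    using SPD_eventually_line[OF A X] by eventually_elim (simp add: levi_civita_eq_christoffel Y Z)
  with christoffel_has_vector_derivative[OF A X, of Y Z]
  have "((\<lambda>t. levi_civita Sym SPD gW (A + t *\<^sub>R X) Y Z) has_vector_derivative
   PY ** A ** sylv A Z + sylv A Z ** A ** PY + sylv A Y ** A ** PZ + PZ ** A ** sylv A Y
      - sylv A Y ** X ** sylv A Z - sylv A Z ** X ** sylv A Y) (at 0)"
    by (subst (asm) has_vector_derivative_cong_ev)
       (auto dest: eventually_nhds_x_imp_x simp: PY_def PZ_def mm.minus_left mm.minus_right algebra_simps)
  then show ?thesis by (simp add: dir_deriv_def vector_derivative_at)
qed

lemma riemann_curvature_const:
  fixes A X Y Z :: "real^'n^'n"
  assumes A: "A \<in> SPD" and X: "X \<in> Sym" and Y: "Y \<in> Sym" and Z: "Z \<in> Sym"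
  defines "G \<equiv> levi_civita Sym SPD gW"
  shows "riemann_curvature G (\<lambda>_. X) (\<lambda>_. Y) (\<lambda>_. Z) A
    = dir_deriv (\<lambda>B. G B Y Z) A X + christoffel A X (christoffel A Y Z)
      - dir_deriv (\<lambda>B. G B X Z) A Y - christoffel A Y (christoffel A X Z)"
proof -
  \<comment> \<open>The bracket of constant fields is zero, so the last curvature term reduces to
    \<open>G A 0 Z\<close>.\<close>
  have "0 \<in> Sym" using subspace_Sym by (rule subspace_0)
  then have "G A 0 Z = 0"
    using levi_civita_eq_christoffel[OF A _ Z, of 0]
    by (simp add: G_def christoffel_def sylv_simps[OF A] mm.zero_left mm.zero_right)
  then show ?thesis
    using levi_civita_eq_christoffel[OF A] christoffel_Sym[OF A] X Y Z
    by (simp add: riemann_curvature_def cov_deriv_def lie_bracket_def dir_deriv_const G_def)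
qed

lemma gW_riemann_curvature:
  fixes A X Y :: "real^'n^'n"
  assumes A: "A \<in> SPD" and X: "X \<in> Sym" and Y: "Y \<in> Sym"
  defines "K \<equiv> sylv A X ** sylv A Y - sylv A Y ** sylv A X"
  defines "N \<equiv> sylv A (A ** K - K ** A)"
  shows "gW A (riemann_curvature (levi_civita Sym SPD gW) (\<lambda>_. X) (\<lambda>_. Y) (\<lambda>_. Y) A) X
    = 3 / 4 * (- trace (K ** A ** K) - trace (N ** A ** N))"
proof -
  define S T where "S = sylv A X" and "T = sylv A Y"
  define Q Q2 where "Q = sylv A (T ** A ** T)" and "Q2 = sylv A (S ** A ** T + T ** A ** S)"
  define W where "W = S ** T + T ** S"
  define P where "P = (1/2) *\<^sub>R W + Q2 + (1/2) *\<^sub>R N"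
  define P' where "P' = (1/2) *\<^sub>R W + Q2 - (1/2) *\<^sub>R N"
  define P2 where "P2 = T ** T + 2 *\<^sub>R Q"
  have XY: "X = A ** S + S ** A" "Y = A ** T + T ** A" by (simp_all add: S_def T_def sylv_eq[OF A])
  have K: "K = S ** T - T ** S" by (simp add: K_def S_def T_def)
  have Q: "A ** Q + Q ** A = T ** A ** T" by (simp add: Q_def sylv_eq[OF A])
  have Q2: "A ** Q2 + Q2 ** A = S ** A ** T + T ** A ** S" by (simp add: Q2_def sylv_eq[OF A])
  have N: "A ** N + N ** A = A ** K - K ** A" by (simp add: N_def sylv_eq[OF A])
  have sP2: "sylv A (Y ** T + T ** Y) = P2"
  proof (rule sylv_eqI[OF A])
    have "A ** P2 + P2 ** A = A ** (T ** T) + T ** T ** A + 2 *\<^sub>R (A ** Q + Q ** A)"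
      by (simp add: P2_def mm_simps algebra_simps)
    then show "A ** P2 + P2 ** A = Y ** T + T ** Y"
      unfolding Q by (simp add: XY(2) mm_simps scaleR_2 algebra_simps)
  qed
  \<comment> \<open>Substituting for \<open>X\<close> gives
    \<open>S ** A ** T + T ** A ** S\<close>, handled by \<open>Q2\<close>, and
    \<open>A ** S ** T + T ** S ** A\<close>, which is half of
    \<open>(A ** W + W ** A) + (A ** K - K ** A)\<close>.\<close>
  have sP: "sylv A (X ** T + T ** X) = P"
  proof (rule sylv_eqI[OF A])
    have "2 *\<^sub>R (A ** P + P ** A) = A ** W + W ** A + 2 *\<^sub>R (A ** Q2 + Q2 ** A) + (A ** N + N ** A)"
      by (simp add: P_def mm_simps algebra_simps)
    also have "\<dots> = 2 *\<^sub>R (X ** T + T ** X)"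
      unfolding Q2 N by (simp add: W_def K XY(1) mm_simps scaleR_2 algebra_simps)
    finally show "A ** P + P ** A = X ** T + T ** X" by simp
  qed
  \<comment> \<open>Exchanging \<open>S\<close> and \<open>T\<close> keeps \<open>W\<close> and
    \<open>Q2\<close> but reverses the sign of \<open>K\<close>, hence that of
    \<open>N\<close>.\<close>
  have sP': "sylv A (Y ** S + S ** Y) = P'"
  proof (rule sylv_eqI[OF A])
    have "2 *\<^sub>R (A ** P' + P' ** A) = A ** W + W ** A + 2 *\<^sub>R (A ** Q2 + Q2 ** A) - (A ** N + N ** A)"
      by (simp add: P'_def mm_simps algebra_simps)
    also have "\<dots> = 2 *\<^sub>R (Y ** S + S ** Y)"
      unfolding Q2 N by (simp add: W_def K XY(2) mm_simps scaleR_2 algebra_simps)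
    finally show "A ** P' + P' ** A = Y ** S + S ** Y" by simp
  qed
  have cYY: "sylv A (christoffel A Y Y) = - (2 *\<^sub>R Q)"
    unfolding christoffel_def T_def[symmetric] scaleR_2[symmetric] by (simp add: Q_def sylv_simps[OF A])
  have cXY: "sylv A (christoffel A X Y) = - Q2"
    by (simp add: christoffel_def Q2_def S_def T_def sylv_simps[OF A])
  define R where "R = riemann_curvature (levi_civita Sym SPD gW) (\<lambda>_. X) (\<lambda>_. Y) (\<lambda>_. Y) A"
  have R_eq: "R = 2 *\<^sub>R (P ** A ** T + T ** A ** P - T ** (A ** S + S ** A) ** T)
      + 2 *\<^sub>R (S ** A ** Q + Q ** A ** S)
      - (P' ** A ** T + T ** A ** P' + S ** A ** P2 + P2 ** A ** S
         - S ** (A ** T + T ** A) ** T - T ** (A ** T + T ** A) ** S)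
      - (T ** A ** Q2 + Q2 ** A ** T)"
    unfolding R_def riemann_curvature_const[OF A X Y Y] dir_deriv_levi_civita[OF A X Y Y]
      dir_deriv_levi_civita[OF A Y X Y] christoffel_def[of A X "christoffel A Y Y"]
      christoffel_def[of A Y "christoffel A X Y"] cYY cXY
      S_def[symmetric] T_def[symmetric] sP sP' sP2 XY[symmetric]
    by (simp only: mm.minus_left mm.minus_right mm.scaleR_left mm.scaleR_right)
       (simp add: scaleR_2 algebra_simps)
  have "R \<in> Sym"
  proof -
    have st: "transpose S = S" "transpose T = T" "transpose A = A" "transpose X = X" "transpose Y = Y"
      using X Y by (auto simp: S_def T_def sylv_Sym A SPD_transpose Sym_def)
    have "transpose P = P" "transpose P' = P'" "transpose P2 = P2" "transpose Q = Q" "transpose Q2 = Q2"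
      unfolding sP[symmetric] sP'[symmetric] sP2[symmetric] Q_def Q2_def
      by (simp_all add: sylv_transpose A transpose_simps matrix_transpose_mul st matrix_mul_assoc add.commute)
    then show ?thesis unfolding R_eq Sym_def
      by (simp add: transpose_simps matrix_transpose_mul st mm_simps algebra_simps)
  qed
  then have "gW A R X = trace (S ** R) / 2" unfolding S_def by (intro gW_half A X)
  also have "\<dots> = 3 / 4 * (- trace (K ** A ** K) - trace (N ** A ** N))"
    unfolding R_eq P_def P'_def P2_def W_def using N unfolding K by (rule curvature_trace_identity)
  finally show ?thesis by (simp add: R_def)
qed

lemma KW_bounds:
  fixes A X Y :: "real^'n^'n"
  assumes A: "A \<in> SPD" and X: "X \<in> Sym" and Y: "Y \<in> Sym"
    and unit: "gW A X X = 1" "gW A Y Y = 1" and orth: "gW A X Y = 0"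
    and nc: "sylv A X ** sylv A Y - sylv A Y ** sylv A X \<noteq> 0"
  shows "0 < KW A X Y" "KW A X Y < 3 / lambda_min A"
proof -
  define S T where "S = sylv A X" and "T = sylv A Y"
  define K where "K = S ** T - T ** S"
  define N where "N = sylv A (A ** K - K ** A)"
  have st: "transpose S = S" "transpose T = T" by (simp_all add: S_def T_def sylv_Sym A X Y)
  have Kt: "transpose K = - K" by (simp add: K_def transpose_simps matrix_transpose_mul st)
  have Nt: "transpose N = N"
    by (simp add: N_def sylv_transpose A transpose_simps matrix_transpose_mul Kt SPD_transpose mm_simps)
  have N: "A ** N + N ** A = A ** K - K ** A" by (simp add: N_def sylv_eq[OF A])
  have KW: "KW A X Y = 3 / 4 * (- trace (K ** A ** K) - trace (N ** A ** N))"
    unfolding KW_def sectional_curvature_def gW_riemann_curvature[OF A X Y] unit orth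
    by (simp add: K_def N_def S_def T_def)
  have "- trace (K ** A ** K) - trace (N ** A ** N) > 0"
    using nc by (intro curvature_form_pos A Kt Nt N) (simp add: K_def S_def T_def)
  then show "0 < KW A X Y" by (simp add: KW)
  \<comment> \<open>Dropping the \<open>N\<close>-term leaves 3/4 of the commutator form, whose
    bound \<open>4 / lambda_min A\<close> produces the constant 3.\<close>
  have "trace (N ** A ** N) \<ge> 0" using SPD_trace_nonneg[OF A, of N] by (simp add: Nt)
  moreover have "- trace (K ** A ** K) < 4 / lambda_min A"
    unfolding K_def using unit nc
    by (intro commutator_form_bound A st) (simp_all add: gW_def S_def T_def)
  ultimately show "KW A X Y < 3 / lambda_min A" by (simp add: KW)
qed

section \<open>The kernel of the commutator pairing\<close>

text \<open>Commuting with the diagonal units \<open>E q q\<close> kills the off-diagonal entries,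
  and commuting with the symmetrized units \<open>E p q\<close> equates the diagonal ones.\<close>

lemma scalar_if_commutes_Sym:
  fixes S :: "real^'n^'n"
  assumes c: "\<And>X. X \<in> Sym \<Longrightarrow> S ** X = X ** S"
  shows "\<exists>s. S = s *\<^sub>R mat 1"
proof -
  define E where "E = (\<lambda>p q. (\<chi> i j. if (i = p \<and> j = q) \<or> (i = q \<and> j = p) then 1 else 0) :: real^'n^'n)"
  have E: "S ** E p q = E p q ** S" for p q
    by (intro c) (auto simp: Sym_def E_def transpose_def vec_eq_iff)
  have off: "S $ p $ q = 0" if "p \<noteq> q" for p q
  proof -
    have "(S ** E q q) $ p $ q = (E q q ** S) $ p $ q" by (simp only: E)
    then show ?thesis using that by (simp add: matrix_matrix_mult_def E_def mult_delta_left mult_delta_right)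
  qed
  have diag: "S $ p $ p = S $ q $ q" if "p \<noteq> q" for p q
  proof -
    have "(S ** E p q) $ p $ q = (E p q ** S) $ p $ q" by (simp only: E)
    then show ?thesis using that
      by (simp add: matrix_matrix_mult_def E_def mult_delta_left mult_delta_right)
  qed
  \<comment> \<open>Any index would do, since all diagonal entries agree.\<close>
  define p where "p = (undefined :: 'n)"
  have "S = (S $ p $ p) *\<^sub>R mat 1"
    using off diag[of _ p] by (force simp: vec_eq_iff mat_def)
  then show ?thesis by blast
qed

theorem theorem6p4:
  fixes A :: "real^'n^'n"
  assumes "A \<in> SPD"
  shows "\<exists>B. orthonormal_basis_of Sym (gW A) B \<and>
           (\<forall>e\<in>B. \<forall>f\<in>B. e \<noteq> f \<longrightarrow> 0 < KW A e f \<and> KW A e f < 3 / lambda_min A)"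
proof -
  define c where "c = (\<lambda>X Y. sylv A X ** sylv A Y - sylv A Y ** sylv A X)"
  have "bilinear c" unfolding bilinear_def c_def
    by (auto intro!: linearI simp: sylv_simps[OF assms] mm_simps algebra_simps)
  then have c: "bounded_bilinear c" by (simp add: bilinear_conv_bounded_bilinear)
  have skew: "c X Y = - c Y X" for X Y by (simp add: c_def)
  \<comment> \<open>Each symmetric \<open>T\<close> is the \<open>sylv A\<close>-image of
    \<open>A ** T + T ** A\<close>, so \<open>sylv A X\<close> commutes with all of
    \<open>Sym\<close> and is a scalar matrix; the Sylvester equation then makes \<open>X\<close> a
    multiple of \<open>A\<close>.\<close>
  have center: "X \<in> span {A}" if X: "X \<in> Sym" and cX: "\<And>Y. Y \<in> Sym \<Longrightarrow> c X Y = 0" for X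
  proof -
    have "sylv A X ** T = T ** sylv A X" if T: "T \<in> Sym" for T
    proof -
      have "A ** T + T ** A \<in> Sym"
        using SPD_transpose[OF assms] T by (intro anticommutator_Sym) (auto simp: Sym_def)
      from cX[OF this] show ?thesis by (simp add: c_def sylv_cancel[OF assms])
    qed
    then obtain s where s: "sylv A X = s *\<^sub>R mat 1" using scalar_if_commutes_Sym by blast
    have "X = (2 * s) *\<^sub>R A"
      using sylv_eq[OF assms, of X] by (simp add: s mm.scaleR_left mm.scaleR_right scaleR_2 flip: scaleR_scaleR)
    then show ?thesis by (simp add: span_scale span_base)
  qed
  obtain B where B: "orthonormal_basis_of Sym (gW A) B"
    "\<And>e f. e \<in> B \<Longrightarrow> f \<in> B \<Longrightarrow> e \<noteq> f \<Longrightarrow> c e f \<noteq> 0"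
    using noncommuting_orthonormal_basis_exists[OF bilinear_gW[OF assms] subspace_Sym
        gW_commute[OF assms] gW_pos[OF assms] c skew center] by blast
  have "0 < KW A e f \<and> KW A e f < 3 / lambda_min A" if ef: "e \<in> B" "f \<in> B" "e \<noteq> f" for e f
    using KW_bounds[OF assms, of e f] B(1) B(2)[OF ef] ef
    unfolding orthonormal_basis_of_def c_def by blast
  then show ?thesis using B(1) by blast
qed

end
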